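(* Let $N\ge 2$, $k,k_1>0$, $k_2=(N-1)k+k_1+\frac12$ and $1^N=(1,1,\dots,1)\in\mathbf{R}^N$. For the polynomials $h_{n,\varepsilon}$ defined in the context and for every $n=0,1,2,\dots$: $$h_{4n,0}(1^N)=\frac{(Nk+1)_n((N-1)k+1)_n}{n!\,(k_2+n)_n},$$ $$h_{4n+1,0}(1^N)=\frac{(Nk+1)_n((N-1)k+1)_n}{n!\,(k_2+n+1)_n},$$ $$h_{4n+2,0}(1^N)=h_{4n+3,1}(1^N)=0,$$ $$h_{4n+1,1}(1^N)=\frac{(Nk+1)_n((N-1)k+1)_n}{n!\,(k_2+n+1)_n},$$ $$h_{4n+3,0}(1^N)=\frac{(Nk+1)_{n+1}((N-1)k+1)_n}{n!\,(k_2+n+1)_{n+1}}.$$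
   Context: Pochhammer symbol: $(a)_0=1$, $(a)_j=a(a+1)\cdots(a+j-1)$. Generating functions ($x\in\mathbf{R}^N$): $$F_0(x;s,t)=\frac{1-st(x_1^2+x_2^2)+t^2x_1^2x_2^2}{(1-2stx_1^2+t^2x_1^4)(1-2stx_2^2+t^2x_2^4)}\prod_{i=1}^N(1-2stx_i^2+t^2x_i^4)^{-k},$$ $$F_1(x;s,t)=\frac{t(x_1^2-x_2^2)}{(1-2stx_1^2+t^2x_1^4)(1-2stx_2^2+t^2x_2^4)}\prod_{i=1}^N(1-2stx_i^2+t^2x_i^4)^{-k}.$$ The polynomials $\phi_{n,j},\psi_{n,j}$ ($0\le j\le n$) in $x$ are defined by the power series expansions $$\sum_{n=0}^\infty\sum_{j=0}^n\phi_{n,j}(x)s^jt^n=F_0+F_1,\qquad \sum_{n=0}^\infty\sum_{j=0}^n\psi_{n,j}(x)s^jt^n=x_1(F_0+sF_1)-x_1F_1 .$$ The polynomials $h_{n,\varepsilon}$: for $n=0,1,2,\dots$, $$h_{4n,0}=\sum_{j=0}^{n}\frac{(2(N-1)k+k_1+\frac12+2n)_j(\frac12)_j}{((N-1)k+k_1+\frac12+n)_j(Nk+n+1)_j}\phi_{2n,2j},$$ $$h_{4n+2,0}=\sum_{j=0}^{n}\frac{(2(N-1)k+k_1+\frac32+2n)_j(\frac12)_j}{((N-1)k+k_1+\frac32+n)_j(Nk+n+2)_j}\phi_{2n+1,2j},$$ $$h_{4n+1,1}=x_1x_2\sum_{j=0}^{n}\frac{(2(N-1)k+k_1+\frac32+2n)_j(\frac12)_j}{((N-1)k+k_1+\frac32+n)_j(Nk+n+1)_j}\phi_{2n,2j},$$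 $$h_{4n+3,1}=x_1x_2\sum_{j=0}^{n}\frac{(2(N-1)k+k_1+\frac52+2n)_j(\frac12)_j}{((N-1)k+k_1+\frac52+n)_j(Nk+n+2)_j}\phi_{2n+1,2j},$$ $$h_{4n+1,0}=\sum_{j=0}^{n}\frac{(2(N-1)k+k_1+\frac32+2n)_j(\frac12)_j}{((N-1)k+k_1+\frac32+n)_j(Nk+n+1)_j}\psi_{2n,2j}+\sum_{j=1}^{n}\frac{(2(N-1)k+k_1+\frac32+2n)_{j-1}(\frac12)_j}{((N-1)k+k_1+\frac32+n)_{j-1}(Nk+n+1)_j}\psi_{2n,2j-1},$$ $$h_{4n+3,0}=\sum_{j=0}^{n}\frac{(2(N-1)k+k_1+\frac52+2n)_j(\frac12)_j}{((N-1)k+k_1+\frac32+n)_j(Nk+n+2)_j}\psi_{2n+1,2j}+\sum_{j=1}^{n+1}\frac{(2(N-1)k+k_1+\frac52+2n)_{j-1}(\frac12)_j}{((N-1)k+k_1+\frac32+n)_j(Nk+n+2)_{j-1}}\psi_{2n+1,2j-1}.$$ *)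

theory Defs
  imports "HOL-Computational_Algebra.Computational_Algebra"
begin

text \<open>
  A point of \<open>R^N\<close> is a function \<open>x :: nat \<Rightarrow> real\<close> of which only the coordinates
  \<open>x 1, \<dots>, x N\<close> are used; polynomials in \<open>x\<close> are treated as functions of \<open>x\<close>.

  For fixed \<open>x\<close> the generating functions are formal power series in \<open>t\<close> whose coefficients are
  polynomials in \<open>s\<close>, that is, elements of \<^typ>\<open>real poly fps\<close>.
\<close>

abbreviation svar :: "real poly fps" where "svar \<equiv> fps_const [:0, 1:]"
abbreviation tvar :: "real poly fps" where "tvar \<equiv> fps_X"
abbreviation cst :: "real \<Rightarrow> real poly fps" where "cst c \<equiv> fps_const [:c:]"

text \<open>
  Since \<^typ>\<open>real poly\<close> is not a field, neither \<^const>\<open>fps_binomial\<close> nor division of power series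
  applies. The power \<open>(1 + u)^a\<close>, for \<open>u\<close> with zero constant term, is the binomial series; the
  lemmas below show that it has the expected properties, in particular that exponent \<open>-1\<close> gives
  the reciprocal.
\<close>

definition binom_series :: "real \<Rightarrow> real poly fps" where
  "binom_series a = Abs_fps (\<lambda>i. [:a gchoose i:])"

definition one_plus_powr :: "real poly fps \<Rightarrow> real \<Rightarrow> real poly fps" where
  "one_plus_powr u a = fps_compose (binom_series a) u"

lemma binom_series_add: "binom_series (a + b) = binom_series a * binom_series b"
proof (rule fps_ext)
  fix n
  have "(\<Sum>i=0..n. [:a gchoose i:] * [:b gchoose (n - i):]) = [:\<Sum>i=0..n. (a gchoose i) * (b gchoose (n - i)):]"
    using sum_to_poly[of "\<lambda>i. (a gchoose i) * (b gchoose (n - i))" "{0..n}"]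
    by (simp add: mult.commute)
  then show "binom_series (a + b) $ n = (binom_series a * binom_series b) $ n"
    by (simp add: binom_series_def fps_mult_nth gbinomial_Vandermonde[symmetric] atLeast0AtMost)
qed

lemma one_plus_powr_0: "one_plus_powr u 0 = 1"
proof -
  have "binom_series 0 = 1"
    by (rule fps_ext) (auto simp: binom_series_def gbinomial_0_left)
  then show ?thesis by (simp add: one_plus_powr_def)
qed

lemma one_plus_powr_1:
  assumes "u $ 0 = 0" shows "one_plus_powr u 1 = 1 + u"
proof -
  have *: "(1::real) gchoose n = (if n \<le> 1 then 1 else 0)" for n
    using binomial_gbinomial[of 1 n, where 'a=real] by (auto simp: binomial_eq_0 le_Suc_eq)
  have "binom_series 1 = 1 + fps_X"
    by (rule fps_ext) (auto simp: binom_series_def * fps_X_def)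
  then show ?thesis using assms by (simp add: one_plus_powr_def fps_compose_add_distrib)
qed

lemma one_plus_powr_add:
  assumes "u $ 0 = 0"
  shows "one_plus_powr u (a + b) = one_plus_powr u a * one_plus_powr u b"
  using assms by (simp add: one_plus_powr_def binom_series_add fps_compose_mult_distrib)

lemma one_plus_powr_minus_1:
  assumes "u $ 0 = 0" shows "(1 + u) * one_plus_powr u (- 1) = 1"
  using one_plus_powr_add[OF assms, of 1 "- 1"] one_plus_powr_0 one_plus_powr_1[OF assms] by simp

text \<open>\<open>quad_powr y a\<close> is \<open>(1 - 2 s t y^2 + t^2 y^4)^a\<close>.\<close>

definition quad_powr :: "real \<Rightarrow> real \<Rightarrow> real poly fps" where
  "quad_powr y a = one_plus_powr (- 2 * svar * tvar * cst (y ^ 2) + tvar ^ 2 * cst (y ^ 4)) a"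

definition genF0 :: "nat \<Rightarrow> real \<Rightarrow> (nat \<Rightarrow> real) \<Rightarrow> real poly fps" where
  "genF0 N k x =
     (1 - svar * tvar * cst ((x 1)^2 + (x 2)^2) + tvar ^ 2 * cst ((x 1)^2 * (x 2)^2))
     * quad_powr (x 1) (- 1) * quad_powr (x 2) (- 1) * (\<Prod>i=1..N. quad_powr (x i) (- k))"

definition genF1 :: "nat \<Rightarrow> real \<Rightarrow> (nat \<Rightarrow> real) \<Rightarrow> real poly fps" where
  "genF1 N k x =
     tvar * cst ((x 1)^2 - (x 2)^2)
     * quad_powr (x 1) (- 1) * quad_powr (x 2) (- 1) * (\<Prod>i=1..N. quad_powr (x i) (- k))"

definition phi_series :: "nat \<Rightarrow> real \<Rightarrow> (nat \<Rightarrow> real) \<Rightarrow> real poly fps" where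
  "phi_series N k x = genF0 N k x + genF1 N k x"

definition psi_series :: "nat \<Rightarrow> real \<Rightarrow> (nat \<Rightarrow> real) \<Rightarrow> real poly fps" where
  "psi_series N k x =
     cst (x 1) * (genF0 N k x + svar * genF1 N k x) - cst (x 1) * genF1 N k x"

definition phi :: "nat \<Rightarrow> real \<Rightarrow> nat \<Rightarrow> nat \<Rightarrow> (nat \<Rightarrow> real) \<Rightarrow> real" where
  "phi N k n j x = coeff (phi_series N k x $ n) j"

definition psi :: "nat \<Rightarrow> real \<Rightarrow> nat \<Rightarrow> nat \<Rightarrow> (nat \<Rightarrow> real) \<Rightarrow> real" where
  "psi N k n j x = coeff (psi_series N k x $ n) j"

text \<open>The coefficient of \<open>s^j t^n\<close> vanishes for \<open>j > n\<close>, so the expansions run over \<open>j \<le> n\<close>.\<close>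

definition triangular :: "real poly fps \<Rightarrow> bool" where
  "triangular F \<longleftrightarrow> (\<forall>n. degree (F $ n) \<le> n)"

lemma triangular_intros:
  "triangular 1" "triangular (- 2)" "triangular (cst c)" "triangular tvar" "triangular (svar * tvar)"
  by (auto simp: triangular_def fps_X_def numeral_fps_const)

lemma triangular_add: "triangular F \<Longrightarrow> triangular G \<Longrightarrow> triangular (F + G)"
  by (auto simp: triangular_def intro: degree_add_le)

lemma triangular_diff: "triangular F \<Longrightarrow> triangular G \<Longrightarrow> triangular (F - G)"
  by (auto simp: triangular_def intro: degree_diff_le)

lemma triangular_mult: "triangular F \<Longrightarrow> triangular G \<Longrightarrow> triangular (F * G)"
  unfolding triangular_def fps_mult_nth
proof (intro allI degree_sum_le)
  fix n i :: nat assume *: "\<forall>n. degree (F $ n) \<le> n" "\<forall>n. degree (G $ n) \<le> n" and "i \<in> {0..n}"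
  have "degree (F $ i * G $ (n - i)) \<le> degree (F $ i) + degree (G $ (n - i))"
    by (rule degree_mult_le)
  also have "\<dots> \<le> i + (n - i)" using * by (intro add_mono) auto
  finally show "degree (F $ i * G $ (n - i)) \<le> n" using \<open>i \<in> {0..n}\<close> by simp
qed simp

lemma triangular_power: "triangular F \<Longrightarrow> triangular (F ^ m)"
  by (induction m) (auto intro: triangular_intros triangular_mult)

lemma triangular_prod: "(\<And>i. i \<in> A \<Longrightarrow> triangular (f i)) \<Longrightarrow> triangular (\<Prod>i\<in>A. f i)"
  by (induction A rule: infinite_finite_induct) (auto intro: triangular_intros triangular_mult)

lemma triangular_one_plus_powr:
  assumes "triangular u" shows "triangular (one_plus_powr u a)"
  unfolding triangular_def one_plus_powr_def fps_compose_nth binom_series_def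
proof (intro allI degree_sum_le)
  fix n i
  show "degree (Abs_fps (\<lambda>i. [:a gchoose i:]) $ i * u ^ i $ n) \<le> n"
    using triangular_power[OF assms, of i] by (simp add: triangular_def order_trans[OF degree_smult_le])
qed simp

lemma triangular_quad_powr: "triangular (quad_powr y a)"
  unfolding quad_powr_def mult.assoc[of "- 2" svar tvar]
  by (intro triangular_one_plus_powr triangular_add triangular_mult triangular_power triangular_intros)

lemma triangular_genF0: "triangular (genF0 N k x)"
  unfolding genF0_def
  by (intro triangular_add triangular_diff triangular_mult triangular_power triangular_prod
      triangular_quad_powr triangular_intros)

lemma triangular_genF1: "triangular (genF1 N k x)"
  unfolding genF1_def
  by (intro triangular_mult triangular_prod triangular_quad_powr triangular_intros)

lemma triangular_svar_genF1: "triangular (svar * genF1 N k x)"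
  unfolding genF1_def mult.assoc[symmetric]
  by (intro triangular_mult triangular_prod triangular_quad_powr triangular_intros)

lemma phi_eq_0:
  assumes "j > n" shows "phi N k n j x = 0"
proof -
  have "triangular (phi_series N k x)"
    unfolding phi_series_def by (intro triangular_add triangular_genF0 triangular_genF1)
  then show ?thesis
    using assms by (auto simp: phi_def triangular_def intro!: coeff_eq_0 intro: le_less_trans)
qed

lemma psi_eq_0:
  assumes "j > n" shows "psi N k n j x = 0"
proof -
  have "triangular (psi_series N k x)"
    unfolding psi_series_def
    by (intro triangular_add triangular_diff triangular_mult triangular_genF0 triangular_genF1
        triangular_svar_genF1 triangular_intros)
  then show ?thesis
    using assms by (auto simp: psi_def triangular_def intro!: coeff_eq_0 intro: le_less_trans)
qed

text \<open>
  \<open>h N k k1 m \<epsilon> x\<close> is the value at \<open>x\<close> of \<open>h_{m,\<epsilon>}\<close>; it is introduced only for \<open>\<epsilon> = 0\<close> with any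
  \<open>m\<close>, and for \<open>\<epsilon> = 1\<close> with \<open>m\<close> odd.
\<close>

definition h :: "nat \<Rightarrow> real \<Rightarrow> real \<Rightarrow> nat \<Rightarrow> nat \<Rightarrow> (nat \<Rightarrow> real) \<Rightarrow> real" where
  "h N k k1 m \<epsilon> x =
    (let n = m div 4; c = (real N - 1) * k + k1; d = 2 * (real N - 1) * k + k1 in
     if m mod 4 = 0 \<and> \<epsilon> = 0 then
       (\<Sum>j=0..n. pochhammer (d + 1/2 + 2 * real n) j * pochhammer (1/2) j
          / (pochhammer (c + 1/2 + real n) j * pochhammer (real N * k + real n + 1) j)
          * phi N k (2*n) (2*j) x)
     else if m mod 4 = 2 \<and> \<epsilon> = 0 then
       (\<Sum>j=0..n. pochhammer (d + 3/2 + 2 * real n) j * pochhammer (1/2) j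
          / (pochhammer (c + 3/2 + real n) j * pochhammer (real N * k + real n + 2) j)
          * phi N k (2*n+1) (2*j) x)
     else if m mod 4 = 1 \<and> \<epsilon> = 1 then
       x 1 * x 2 *
       (\<Sum>j=0..n. pochhammer (d + 3/2 + 2 * real n) j * pochhammer (1/2) j
          / (pochhammer (c + 3/2 + real n) j * pochhammer (real N * k + real n + 1) j)
          * phi N k (2*n) (2*j) x)
     else if m mod 4 = 3 \<and> \<epsilon> = 1 then
       x 1 * x 2 *
       (\<Sum>j=0..n. pochhammer (d + 5/2 + 2 * real n) j * pochhammer (1/2) j
          / (pochhammer (c + 5/2 + real n) j * pochhammer (real N * k + real n + 2) j)
          * phi N k (2*n+1) (2*j) x)
     else if m mod 4 = 1 \<and> \<epsilon> = 0 then
       (\<Sum>j=0..n. pochhammer (d + 3/2 + 2 * real n) j * pochhammer (1/2) j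
          / (pochhammer (c + 3/2 + real n) j * pochhammer (real N * k + real n + 1) j)
          * psi N k (2*n) (2*j) x)
       + (\<Sum>j=1..n. pochhammer (d + 3/2 + 2 * real n) (j-1) * pochhammer (1/2) j
          / (pochhammer (c + 3/2 + real n) (j-1) * pochhammer (real N * k + real n + 1) j)
          * psi N k (2*n) (2*j-1) x)
     else if m mod 4 = 3 \<and> \<epsilon> = 0 then
       (\<Sum>j=0..n. pochhammer (d + 5/2 + 2 * real n) j * pochhammer (1/2) j
          / (pochhammer (c + 3/2 + real n) j * pochhammer (real N * k + real n + 2) j)
          * psi N k (2*n+1) (2*j) x)
       + (\<Sum>j=1..n+1. pochhammer (d + 5/2 + 2 * real n) (j-1) * pochhammer (1/2) j
          / (pochhammer (c + 3/2 + real n) j * pochhammer (real N * k + real n + 2) (j-1))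
          * psi N k (2*n+1) (2*j-1) x)
     else undefined)"

definition ones :: "nat \<Rightarrow> real" where
  "ones = (\<lambda>_. 1)"

end

theory Submission
  imports Defs
begin

text \<open>
  At \<open>1\<^sup>N\<close> the factor \<open>x\<^sub>1\<^sup>2 - x\<^sub>2\<^sup>2\<close> kills \<open>F\<^sub>1\<close>, and the numerator of \<open>F\<^sub>0\<close> becomes one more
  copy of \<open>1 - 2st + t\<^sup>2\<close>. Hence both generating functions collapse to
  \<open>(1 - 2st + t\<^sup>2)\<^sup>-\<^sup>\<lambda>\<close> with \<open>\<lambda> = Nk + 1\<close>, the generating function of the Gegenbauer polynomials
  (\<open>phi_ones\<close>, \<open>psi_ones\<close>). The values \<open>\<phi>\<^sub>n\<^sub>,\<^sub>j(1\<^sup>N) = \<psi>\<^sub>n\<^sub>,\<^sub>j(1\<^sup>N)\<close> are therefore the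
  coefficients of the Gegenbauer polynomial of degree \<open>n\<close>.

  Gegenbauer polynomials have the parity of their degree. This gives the two zero values, and in each
  of the polynomials built from \<open>\<psi>\<close> it leaves only one of the two sums. In a surviving sum the
  Gegenbauer coefficient carries \<open>(\<lambda>)\<^sub>n\<^sub>+\<^sub>j = (\<lambda>)\<^sub>n (\<lambda> + n)\<^sub>j\<close>, which cancels the second
  denominator, and a factor that cancels \<open>(1/2)\<^sub>j\<close> by the duplication formula for factorials. What
  remains is a terminating \<open>\<^sub>2F\<^sub>1\<close> at 1, summed by Chu--Vandermonde
  (\<open>sum_gegenbauer_even\<close>, \<open>sum_gegenbauer_odd\<close>); its parameters differ by
  \<open>(N-1)k + n\<close>, whence the factor \<open>((N-1)k + 1)\<^sub>n\<close>.
\<close>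

text \<open>Chu--Vandermonde with the sign moved so that the right-hand side has none: this is where
  \<open>(b - a)\<^sub>n\<close> is reflected into \<open>(a - b - n + 1)\<^sub>n\<close>.\<close>

lemma Vandermonde_pochhammer_alternating:
  fixes a b :: real
  assumes "b > 0"
  shows "(\<Sum>j=0..n. (-1) ^ (n - j) * pochhammer a j / (fact (n - j) * fact j * pochhammer b j))
    = pochhammer (a - b - real n + 1) n / (fact n * pochhammer b n)"
proof -
  have "(-1) ^ (n - j) * pochhammer a j / (fact (n - j) * fact j * pochhammer b j)
      = (-1) ^ n / fact n * (pochhammer a j * pochhammer (- real n) j / (fact j * pochhammer b j))"
    if "j \<le> n" for j
  proof -
    have "(fact j :: real) * (real n gchoose j) * fact (n - j) = fact n"
      using binomial_fact_lemma[OF that, THEN arg_cong[of _ _ real]]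
      by (simp add: binomial_gbinomial mult_ac)
    then have "pochhammer (- real n) j = (-1) ^ j * fact n / fact (n - j)"
      by (cases "even j") (simp_all add: gbinomial_pochhammer field_simps)
    moreover have "((-1) ^ (n - j) :: real) = (-1) ^ n * (-1) ^ j"
      using that by (simp add: minus_one_power_iff)
    ultimately show ?thesis by (simp add: mult_ac)
  qed
  then have "(\<Sum>j=0..n. (-1) ^ (n - j) * pochhammer a j / (fact (n - j) * fact j * pochhammer b j))
      = (-1) ^ n / fact n
        * (\<Sum>j=0..n. pochhammer a j * pochhammer (- real n) j / (fact j * pochhammer b j))"
    unfolding sum_distrib_left by (intro sum.cong) auto
  also have "(\<Sum>j=0..n. pochhammer a j * pochhammer (- real n) j / (fact j * pochhammer b j))
      = pochhammer (b - a) n / pochhammer b n"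
    using Vandermonde_pochhammer[of n b a] assms by simp
  also have "pochhammer (b - a) n = (-1) ^ n * pochhammer (a - b - real n + 1) n"
    using pochhammer_minus[of "a - b" n] by simp
  also have "(-1) ^ n / fact n * ((-1) ^ n * pochhammer (a - b - real n + 1) n / pochhammer b n)
      = pochhammer (a - b - real n + 1) n / (fact n * pochhammer b n)"
    using power_mult_distrib[of "-1::real" "-1" n] by (simp add: field_simps)
  finally show ?thesis .
qed

section \<open>Coefficients of the Gegenbauer polynomials\<close>

text \<open>\<open>gegenbauer_coeff \<lambda> n j\<close> is the coefficient of \<open>s\<^sup>j\<close> in the Gegenbauer polynomial
  \<open>C\<^sub>n(s)\<close> of order \<open>\<lambda>\<close>.\<close>

definition gegenbauer_coeff :: "real \<Rightarrow> nat \<Rightarrow> nat \<Rightarrow> real" where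
  "gegenbauer_coeff l n j = coeff (quad_powr 1 (- l) $ n) j"

text \<open>The binomial series is taken in \<open>u = t (t - 2s)\<close>, so that \<open>u\<^sup>i\<close> contributes to \<open>t\<^sup>n\<close>
  exactly the coefficient of \<open>t\<^sup>n\<^sup>-\<^sup>i\<close> in \<open>(t - 2s)\<^sup>i\<close>, a monomial in \<open>s\<close>.\<close>

lemma coeff_quad_powr_1:
  "coeff (quad_powr 1 a $ n) j =
    (\<Sum>i=0..n. if n + j = 2 * i then (a gchoose i) * real (i choose (n - i)) * (-2) ^ j else 0)"
proof -
  let ?p = "[:0, -2:] :: real poly"
  have u: "- 2 * svar * tvar * cst (1 ^ 2) + tvar ^ 2 * cst (1 ^ 4) = tvar * (tvar + fps_const ?p)"
  proof -
    have "fps_const ?p = - 2 * svar"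
      by (simp add: numeral_fps_const fps_const_neg fps_const_mult numeral_poly)
    moreover have "cst 1 = 1" by (simp flip: one_pCons)
    ultimately show ?thesis by (simp add: algebra_simps power2_eq_square)
  qed
  have pow: "(tvar + fps_const ?p) ^ i $ m = of_nat (i choose m) * ?p ^ (i - m)" for i m
  proof -
    have "(tvar + fps_const ?p) ^ i $ m
        = (\<Sum>r\<le>i. (of_nat (i choose r) * tvar ^ r * fps_const ?p ^ (i - r)) $ m)"
      by (simp only: binomial_ring fps_sum_nth)
    also have "\<dots> = (\<Sum>r\<le>i. if r = m then of_nat (i choose r) * ?p ^ (i - r) else 0)"
      by (intro sum.cong)
        (auto simp: fps_of_nat[symmetric] fps_const_power fps_X_power_iff mult.assoc
          simp del: fps_of_nat)
    finally show ?thesis by (auto simp: binomial_eq_0)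
  qed
  have p: "?p ^ e = monom ((-2) ^ e) e" for e
    using monom_power[of "-2 :: real" 1 e] by (simp add: monom_Suc monom_0)
  have "quad_powr 1 a $ n = (\<Sum>i=0..n. [:a gchoose i:] * ((tvar * (tvar + fps_const ?p)) ^ i $ n))"
    by (simp only: quad_powr_def one_plus_powr_def u fps_compose_nth binom_series_def fps_nth_Abs_fps)
  also have "\<dots> = (\<Sum>i=0..n. smult (a gchoose i) (of_nat (i choose (n - i)) * ?p ^ (i - (n - i))))"
    by (intro sum.cong) (auto simp: power_mult_distrib fps_X_power_mult_nth pow)
  finally have "coeff (quad_powr 1 a $ n) j =
      (\<Sum>i=0..n. (a gchoose i) * (real (i choose (n - i)) * coeff (?p ^ (i - (n - i))) j))"
    by (simp add: coeff_sum of_nat_poly mult.assoc)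
  also have "\<dots> = (\<Sum>i=0..n. if n + j = 2 * i
      then (a gchoose i) * real (i choose (n - i)) * (-2) ^ j else 0)"
  proof (intro sum.cong refl)
    fix i assume i: "i \<in> {0..n}"
    (* For i < n - i the truncated exponent is 0 and could match j = 0, but the binomial is 0. *)
    show "(a gchoose i) * (real (i choose (n - i)) * coeff (?p ^ (i - (n - i))) j) =
      (if n + j = 2 * i then (a gchoose i) * real (i choose (n - i)) * (-2) ^ j else 0)"
      using i by (cases "n - i \<le> i") (auto simp: p binomial_eq_0)
  qed
  finally show ?thesis .
qed

lemma gegenbauer_coeff_odd:
  assumes "odd (n + j)" shows "gegenbauer_coeff l n j = 0"
  unfolding gegenbauer_coeff_def coeff_quad_powr_1 using assms
  by (intro sum.neutral) (metis dvd_triv_left)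

text \<open>Writing the degree as \<open>2r + j\<close> makes \<open>i = r + j\<close> the only surviving term of the binomial
  series, and both signs \<open>(-1)\<^sup>j\<close>, from \<open>(-2)\<^sup>j\<close> and from the binomial coefficient, cancel.\<close>

lemma gegenbauer_coeff_eq:
  "gegenbauer_coeff l (2 * r + j) j = (-1) ^ r * 2 ^ j * pochhammer l (r + j) / (fact r * fact j)"
proof -
  have "gegenbauer_coeff l (2 * r + j) j =
      (\<Sum>i=0..2 * r + j. if i = r + j
         then (- l gchoose (r + j)) * real ((r + j) choose r) * (-2) ^ j else 0)"
    unfolding gegenbauer_coeff_def coeff_quad_powr_1 by (intro sum.cong) auto
  also have "\<dots> = (- l gchoose (r + j)) * real ((r + j) choose r) * (-2) ^ j" by simp
  also have "real ((r + j) choose r) = fact (r + j) / (fact r * fact j)"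
    by (simp add: binomial_fact)
  also have "(-2 :: real) ^ j = (-1) ^ j * 2 ^ j"
    by (simp flip: power_mult_distrib)
  also have "- l gchoose (r + j) = (-1) ^ r * (-1) ^ j * pochhammer l (r + j) / fact (r + j)"
    by (simp add: gbinomial_pochhammer power_add)
  finally show ?thesis
    using power_mult_distrib[of "-1::real" "-1" j] by (simp add: field_simps)
qed

section \<open>Sums over Gegenbauer coefficients\<close>

lemma sum_gegenbauer_even:
  fixes a b l :: real
  assumes "b > 0" "l > 0"
  shows "(\<Sum>j=0..n. pochhammer a j * pochhammer (1/2) j
            / (pochhammer b j * pochhammer (l + real n) j) * gegenbauer_coeff l (2 * n) (2 * j))
    = pochhammer l n * pochhammer (a - b - real n + 1) n / (fact n * pochhammer b n)"
proof -
  have "pochhammer a j * pochhammer (1/2) j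
          / (pochhammer b j * pochhammer (l + real n) j) * gegenbauer_coeff l (2 * n) (2 * j)
      = pochhammer l n
          * ((-1) ^ (n - j) * pochhammer a j / (fact (n - j) * fact j * pochhammer b j))"
    if "j \<le> n" for j
  proof -
    have "2 * n = 2 * (n - j) + 2 * j" using that by simp
    then have "gegenbauer_coeff l (2 * n) (2 * j)
        = (-1) ^ (n - j) * 2 ^ (2 * j) * pochhammer l (n - j + 2 * j) / (fact (n - j) * fact (2 * j))"
      using gegenbauer_coeff_eq[of l "n - j" "2 * j"] by simp
    also have "n - j + 2 * j = n + j" using that by simp
    also have "pochhammer l (n + j) = pochhammer l n * pochhammer (l + real n) j"
      by (rule pochhammer_product')
    also have "(fact (2 * j) :: real) = 2 ^ (2 * j) * pochhammer (1/2) j * fact j"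
      by (rule fact_double)
    finally have *: "gegenbauer_coeff l (2 * n) (2 * j) = (-1) ^ (n - j) * 2 ^ (2 * j)
        * (pochhammer l n * pochhammer (l + real n) j)
        / (fact (n - j) * (2 ^ (2 * j) * pochhammer (1/2) j * fact j))" .
    have "pochhammer (1/2 :: real) j \<noteq> 0" "pochhammer (l + real n) j \<noteq> 0" "pochhammer b j \<noteq> 0"
      using assms pochhammer_pos[of "1/2 :: real" j] pochhammer_pos[of "l + real n" j]
        pochhammer_pos[of b j] by auto
    then show ?thesis unfolding * by (simp add: divide_simps)
  qed
  then have "(\<Sum>j=0..n. pochhammer a j * pochhammer (1/2) j
        / (pochhammer b j * pochhammer (l + real n) j) * gegenbauer_coeff l (2 * n) (2 * j))
      = pochhammer l n
        * (\<Sum>j=0..n. (-1) ^ (n - j) * pochhammer a j / (fact (n - j) * fact j * pochhammer b j))"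
    unfolding sum_distrib_left by (intro sum.cong) auto
  also have "\<dots> = pochhammer l n * pochhammer (a - b - real n + 1) n / (fact n * pochhammer b n)"
    unfolding Vandermonde_pochhammer_alternating[OF \<open>b > 0\<close>] by simp
  finally show ?thesis .
qed

text \<open>Compared with the even case the denominator \<open>(b)\<^sub>j\<close> is ahead of \<open>(a)\<^sub>j\<^sub>-\<^sub>1\<close> by one; the
  extra factor \<open>b\<close> is pulled out and Chu--Vandermonde is applied with \<open>b + 1\<close>.\<close>

lemma sum_gegenbauer_odd:
  fixes a b l :: real
  assumes "b > 0" "l > 0"
  shows "(\<Sum>j=1..n+1. pochhammer a (j-1) * pochhammer (1/2) j
            / (pochhammer b j * pochhammer (l + real n + 1) (j-1))
            * gegenbauer_coeff l (2 * n + 1) (2 * j - 1))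
    = pochhammer l (n+1) * pochhammer (a - b - real n) n / (fact n * pochhammer b (n+1))"
proof -
  have "pochhammer a j * pochhammer (1/2) (Suc j)
          / (pochhammer b (Suc j) * pochhammer (l + real n + 1) j)
          * gegenbauer_coeff l (2 * n + 1) (2 * j + 1)
      = pochhammer l (n+1) / b
          * ((-1) ^ (n - j) * pochhammer a j / (fact (n - j) * fact j * pochhammer (b + 1) j))"
    if "j \<le> n" for j
  proof -
    have "2 * n + 1 = 2 * (n - j) + (2 * j + 1)" using that by simp
    then have "gegenbauer_coeff l (2 * n + 1) (2 * j + 1)
        = (-1) ^ (n - j) * 2 ^ (2 * j + 1) * pochhammer l (n - j + (2 * j + 1))
          / (fact (n - j) * fact (2 * j + 1))"
      using gegenbauer_coeff_eq[of l "n - j" "2 * j + 1"] by metis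
    also have "n - j + (2 * j + 1) = n + 1 + j" using that by simp
    also have "pochhammer l (n + 1 + j) = pochhammer l (n+1) * pochhammer (l + real n + 1) j"
      using pochhammer_product'[of l "n+1" j] by (simp add: add_ac)
    (* Duplication formula at an odd argument: (2j+1)! = (2j+1) (2j)! and
       (1/2)_(j+1) = (1/2)_j (2j+1)/2. *)
    also have "(fact (2 * j + 1) :: real) = 2 ^ (2 * j + 1) * pochhammer (1/2) (Suc j) * fact j"
      using fact_double[of j, where 'a = real] by (simp add: pochhammer_rec' field_simps)
    finally have *: "gegenbauer_coeff l (2 * n + 1) (2 * j + 1) = (-1) ^ (n - j) * 2 ^ (2 * j + 1)
        * (pochhammer l (n+1) * pochhammer (l + real n + 1) j)
        / (fact (n - j) * (2 ^ (2 * j + 1) * pochhammer (1/2) (Suc j) * fact j))" .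
    have nz: "pochhammer (1/2 :: real) (Suc j) \<noteq> 0" "pochhammer (l + real n + 1) j \<noteq> 0"
        "pochhammer (b + 1) j \<noteq> 0"
      using assms pochhammer_pos[of "1/2 :: real" "Suc j"] pochhammer_pos[of "l + real n + 1" j]
        pochhammer_pos[of "b + 1" j] by auto
    show ?thesis
      unfolding * pochhammer_rec[of b] using nz assms by (simp add: divide_simps del: power_Suc)
  qed
  then have "(\<Sum>j=0..n. pochhammer a j * pochhammer (1/2) (Suc j)
          / (pochhammer b (Suc j) * pochhammer (l + real n + 1) j)
          * gegenbauer_coeff l (2 * n + 1) (2 * j + 1))
      = pochhammer l (n+1) / b
        * (\<Sum>j=0..n. (-1) ^ (n - j) * pochhammer a j / (fact (n - j) * fact j * pochhammer (b + 1) j))"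
    unfolding sum_distrib_left by (intro sum.cong) auto
  also have "\<dots> = pochhammer l (n+1) / b
        * (pochhammer (a - (b + 1) - real n + 1) n / (fact n * pochhammer (b + 1) n))"
    using assms by (subst Vandermonde_pochhammer_alternating) auto
  also have "a - (b + 1) - real n + 1 = a - b - real n" by simp
  also have "pochhammer l (n+1) / b * (pochhammer (a - b - real n) n / (fact n * pochhammer (b + 1) n))
      = pochhammer l (n+1) * pochhammer (a - b - real n) n / (fact n * pochhammer b (n+1))"
    by (simp add: pochhammer_rec[of b] mult_ac)
  finally show ?thesis
    using sum.shift_bounds_cl_Suc_ivl[where m = 0 and n = n and g = "\<lambda>j. pochhammer a (j-1)
        * pochhammer (1/2) j / (pochhammer b j * pochhammer (l + real n + 1) (j-1))
        * gegenbauer_coeff l (2 * n + 1) (2 * j - 1)"]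
    by simp
qed

section \<open>Evaluation at \<open>1\<^sup>N\<close>\<close>

lemma quad_powr_add: "quad_powr y (a + b) = quad_powr y a * quad_powr y b"
  unfolding quad_powr_def by (rule one_plus_powr_add) simp

lemma quad_powr_1: "quad_powr y 1 = 1 + (- 2 * svar * tvar * cst (y ^ 2) + tvar ^ 2 * cst (y ^ 4))"
  unfolding quad_powr_def by (rule one_plus_powr_1) simp

lemma prod_quad_powr_const: "(\<Prod>i=1..N. quad_powr y a) = quad_powr y (real N * a)"
proof (induction N)
  case 0
  show ?case by (simp add: quad_powr_def one_plus_powr_0)
next
  case (Suc N)
  then show ?case by (simp add: algebra_simps quad_powr_add)
qed

lemma genF0_ones: "genF0 N k ones = quad_powr 1 (- (real N * k + 1))"
proof -
  have "cst (1 ^ 2 + 1 ^ 2) = 2" "cst 1 = 1"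
    by (simp_all add: numeral_fps_const numeral_poly flip: one_pCons)
  then have "genF0 N k ones = quad_powr 1 1 * quad_powr 1 (- 1) * quad_powr 1 (- 1)
      * (\<Prod>i=1..N. quad_powr 1 (- k))"
    by (simp add: genF0_def ones_def quad_powr_1 mult_ac)
  also have "\<dots> = quad_powr 1 (1 + - 1 + - 1 + real N * - k)"
    by (simp only: quad_powr_add prod_quad_powr_const)
  finally show ?thesis by (simp add: algebra_simps)
qed

lemma genF1_ones: "genF1 N k ones = 0"
  by (simp add: genF1_def ones_def)

lemma phi_ones: "phi N k n j ones = gegenbauer_coeff (real N * k + 1) n j"
  by (simp add: phi_def phi_series_def genF0_ones genF1_ones gegenbauer_coeff_def)

lemma psi_ones: "psi N k n j ones = gegenbauer_coeff (real N * k + 1) n j"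
proof -
  have "cst (ones 1) = 1" by (simp add: ones_def flip: one_pCons)
  then show ?thesis
    by (simp add: psi_def psi_series_def genF0_ones genF1_ones gegenbauer_coeff_def)
qed

theorem proposition5:
  fixes N n :: nat and k k1 k2 :: real
  assumes "N \<ge> 2" and "k > 0" and "k1 > 0"
    and "k2 = (real N - 1) * k + k1 + 1/2"
  shows
    "h N k k1 (4*n) 0 ones =
       pochhammer (real N * k + 1) n * pochhammer ((real N - 1) * k + 1) n
       / (fact n * pochhammer (k2 + real n) n) \<and>
     h N k k1 (4*n+1) 0 ones =
       pochhammer (real N * k + 1) n * pochhammer ((real N - 1) * k + 1) n
       / (fact n * pochhammer (k2 + real n + 1) n) \<and>
     h N k k1 (4*n+2) 0 ones = 0 \<and>
     h N k k1 (4*n+3) 1 ones = 0 \<and>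
     h N k k1 (4*n+1) 1 ones =
       pochhammer (real N * k + 1) n * pochhammer ((real N - 1) * k + 1) n
       / (fact n * pochhammer (k2 + real n + 1) n) \<and>
     h N k k1 (4*n+3) 0 ones =
       pochhammer (real N * k + 1) (n+1) * pochhammer ((real N - 1) * k + 1) n
       / (fact n * pochhammer (k2 + real n + 1) (n+1))"
proof -
  define l c d where "l = real N * k + 1" and "c = (real N - 1) * k + k1"
    and "d = 2 * (real N - 1) * k + k1"
  have l: "l > 0" using assms by (simp add: l_def add_nonneg_pos)
  have c: "c > 0" using assms by (simp add: c_def add_nonneg_pos)
  have k2: "k2 = c + 1/2" using assms by (simp add: c_def)
  have dc: "d - c = (real N - 1) * k" by (simp add: c_def d_def)
  have den: "real N * k + real n + 1 = l + real n" "real N * k + real n + 2 = l + real n + 1"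
    by (simp_all add: l_def)
  have m: "(4 * n) mod 4 = 0" "(4 * n + 1) mod 4 = 1" "(4 * n + 2) mod 4 = 2"
      "(4 * n + 3) mod 4 = 3" "(4 * n) div 4 = n" "(4 * n + 1) div 4 = n" "(4 * n + 2) div 4 = n"
      "(4 * n + 3) div 4 = n"
    by presburger+
  note h_simps = h_def Let_def m phi_ones psi_ones den c_def[symmetric] d_def[symmetric]
    l_def[symmetric]
  have even_diff: "d + 1/2 + 2 * real n - (c + 1/2 + real n) - real n + 1 = (real N - 1) * k + 1"
      "d + 3/2 + 2 * real n - (c + 3/2 + real n) - real n + 1 = (real N - 1) * k + 1"
    and odd_diff: "d + 5/2 + 2 * real n - (c + 3/2 + real n) - real n = (real N - 1) * k + 1"
    using dc by simp_all
  have ones: "ones i = 1" for i by (simp add: ones_def)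
  have c32: "c + 3/2 + real n = k2 + real n + 1" and c12: "c + 1/2 + real n = k2 + real n"
    by (simp_all add: k2)

  have sum1: "(\<Sum>j=0..n. pochhammer (d + 3/2 + 2 * real n) j * pochhammer (1/2) j
      / (pochhammer (c + 3/2 + real n) j * pochhammer (l + real n) j)
      * gegenbauer_coeff l (2 * n) (2 * j))
    = pochhammer l n * pochhammer ((real N - 1) * k + 1) n
      / (fact n * pochhammer (k2 + real n + 1) n)"
    using sum_gegenbauer_even[of "c + 3/2 + real n" l "d + 3/2 + 2 * real n" n] l c
    unfolding even_diff by (simp add: c32[symmetric])
  have h0: "h N k k1 (4*n) 0 ones =
       pochhammer l n * pochhammer ((real N - 1) * k + 1) n / (fact n * pochhammer (k2 + real n) n)"
    using sum_gegenbauer_even[of "c + 1/2 + real n" l "d + 1/2 + 2 * real n" n] l c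
    unfolding even_diff h_simps by (simp add: c12[symmetric])
  have h11: "h N k k1 (4*n+1) 1 ones = pochhammer l n * pochhammer ((real N - 1) * k + 1) n
       / (fact n * pochhammer (k2 + real n + 1) n)"
    unfolding sum1[symmetric] h_simps by (simp add: ones)
  have h10: "h N k k1 (4*n+1) 0 ones = pochhammer l n * pochhammer ((real N - 1) * k + 1) n
       / (fact n * pochhammer (k2 + real n + 1) n)"
    unfolding sum1[symmetric] h_simps by (simp add: gegenbauer_coeff_odd)
  have h2: "h N k k1 (4*n+2) 0 ones = 0"
    unfolding h_simps by (simp add: gegenbauer_coeff_odd)
  have h31: "h N k k1 (4*n+3) 1 ones = 0"
    unfolding h_simps by (simp add: gegenbauer_coeff_odd)
  have h30: "h N k k1 (4*n+3) 0 ones = pochhammer l (n+1) * pochhammer ((real N - 1) * k + 1) n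
       / (fact n * pochhammer (k2 + real n + 1) (n+1))"
  proof -
    have "h N k k1 (4*n+3) 0 ones = (\<Sum>j=1..n+1. pochhammer (d + 5/2 + 2 * real n) (j-1)
        * pochhammer (1/2) j / (pochhammer (c + 3/2 + real n) j * pochhammer (l + real n + 1) (j-1))
        * gegenbauer_coeff l (2 * n + 1) (2 * j - 1))"
      unfolding h_simps by (simp add: gegenbauer_coeff_odd del: sum.cl_ivl_Suc)
    also have "\<dots> = pochhammer l (n+1) * pochhammer ((real N - 1) * k + 1) n
       / (fact n * pochhammer (c + 3/2 + real n) (n+1))"
      using l c by (subst sum_gegenbauer_odd) (auto simp only: odd_diff)
    finally show ?thesis by (simp only: c32)
  qed
  show ?thesis using h0 h10 h2 h31 h11 h30 unfolding l_def by blast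
qed

end
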